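(* Let $M,N,S$ be positive integers with $M>N$, and let $Q$ denote the I/O complexity (minimum number of Load moves over all complete red-white pebble games with $S$ red pebbles) of the CDAG of the Householder QR program (V2Q part) below applied to an $M\times N$ array $A$. Then $$\frac{N (N-1)(3M-N-1)(M-N)^2}{24 ( (M-N)^2 + SM )} \leq Q .$$
   Context: Program (Householder QR, V2Q part, corresponding to LAPACK ORG2R), with input $M\times N$ array $A$ and input array $tau$ of length $N$: for k = N-1, N-2, ..., 0: for j = k+1,...,N-1: tau[j] = 0.0 for i = k+1,...,M-1: tau[j] += A[i][k]*A[i][j] for j = k+1,...,N-1: tau[j] *= tau[k] A[k][k] = 1.0 - tau[k] for j = k+1,...,N-1: A[k][j] = -tau[j] for j = k+1,...,N-1: for i = k+1,...,M-1: A[i][j] -= A[i][k]*tau[j] for i = k+1,...,M-1: A[i][k] = -A[i][k]*tau[k] CDAG of a program: a directed acyclic graph whose nodes are the input values (initial values of array entries read before being written) and the statement instances (each execution of an assignment statement, including compound assignments), with an edge $u\to v$ whenever the instance $v$ reads a value produced by $u$ (flow dependence). Input nodes have no incoming edges. Red-white pebble game with $S$ red pebbles on a CDAG: initially only the input nodes carry white pebbles and there are no red pebbles. Allowed moves: (Spill) remove a red pebble from a node; (Compute) if a node has no white pebble and all its predecessors carry red pebbles, place a white and a red pebble on it; (Load) place a red pebble on a node carrying a white pebble. At no time may more than $S$ red pebbles be on the graph. The game is complete when every node carries a white pebble. The I/O complexity $Q$ is the minimum, over all complete games, of the number of Load moves. *)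

theory Defs
  imports "HOL-Library.Extended_Real"
begin

subsection \<open>CDAG of a program\<close>

text \<open>
  A (straight-line) execution is given by the list of its statement instances in execution order;
  \<open>reads s\<close> is the set of memory locations read by the instance \<open>s\<close>, and \<open>target s\<close> is the location
  it assigns.  Statement instances are identified with the entries of the list, so the list
  is meant to be distinct (see \<open>distinct_v2q_trace\<close> below).
\<close>

datatype ('l, 's) node = Input 'l | Instance 's

definition reads_initial :: "('s \<Rightarrow> 'l set) \<Rightarrow> ('s \<Rightarrow> 'l) \<Rightarrow> 's list \<Rightarrow> 'l \<Rightarrow> 's \<Rightarrow> bool" where
  "reads_initial reads target tr l v \<longleftrightarrow>
     (\<exists>xs ys. tr = xs @ v # ys \<and> l \<in> reads v \<and> (\<forall>w\<in>set xs. target w \<noteq> l))"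

definition flow_dep :: "('s \<Rightarrow> 'l set) \<Rightarrow> ('s \<Rightarrow> 'l) \<Rightarrow> 's list \<Rightarrow> 's \<Rightarrow> 's \<Rightarrow> bool" where
  "flow_dep reads target tr u v \<longleftrightarrow>
     (\<exists>xs ys zs. tr = xs @ u # ys @ v # zs \<and> target u \<in> reads v \<and>
        (\<forall>w\<in>set ys. target w \<noteq> target u))"

definition cdag_inputs :: "('s \<Rightarrow> 'l set) \<Rightarrow> ('s \<Rightarrow> 'l) \<Rightarrow> 's list \<Rightarrow> ('l, 's) node set" where
  "cdag_inputs reads target tr = {Input l | l. \<exists>v. reads_initial reads target tr l v}"

definition cdag_nodes :: "('s \<Rightarrow> 'l set) \<Rightarrow> ('s \<Rightarrow> 'l) \<Rightarrow> 's list \<Rightarrow> ('l, 's) node set" where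
  "cdag_nodes reads target tr = cdag_inputs reads target tr \<union> Instance ` set tr"

definition cdag_edges :: "('s \<Rightarrow> 'l set) \<Rightarrow> ('s \<Rightarrow> 'l) \<Rightarrow> 's list \<Rightarrow> ('l, 's) node rel" where
  "cdag_edges reads target tr =
     {(Input l, Instance v) | l v. reads_initial reads target tr l v} \<union>
     {(Instance u, Instance v) | u v. flow_dep reads target tr u v}"

subsection \<open>Red-white pebble game\<close>

datatype 'v move = Spill 'v | Compute 'v | is_Load: Load 'v

text \<open>A state \<open>(R, W)\<close> consists of the nodes carrying red and those carrying white pebbles.\<close>

inductive pebble_step ::
  "nat \<Rightarrow> 'v set \<Rightarrow> 'v rel \<Rightarrow> 'v set \<times> 'v set \<Rightarrow> 'v move \<Rightarrow> 'v set \<times> 'v set \<Rightarrow> bool"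
  for S :: nat and V :: "'v set" and E :: "'v rel" where
  spill: "v \<in> R \<Longrightarrow> pebble_step S V E (R, W) (Spill v) (R - {v}, W)"
| compute: "v \<in> V \<Longrightarrow> v \<notin> W \<Longrightarrow> (\<And>u. (u, v) \<in> E \<Longrightarrow> u \<in> R) \<Longrightarrow> card (insert v R) \<le> S \<Longrightarrow>
    pebble_step S V E (R, W) (Compute v) (insert v R, insert v W)"
| load: "v \<in> W \<Longrightarrow> card (insert v R) \<le> S \<Longrightarrow>
    pebble_step S V E (R, W) (Load v) (insert v R, W)"

inductive pebble_play ::
  "nat \<Rightarrow> 'v set \<Rightarrow> 'v rel \<Rightarrow> 'v set \<times> 'v set \<Rightarrow> 'v move list \<Rightarrow> 'v set \<times> 'v set \<Rightarrow> bool"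
  for S :: nat and V :: "'v set" and E :: "'v rel" where
  Nil: "pebble_play S V E s [] s"
| Cons: "pebble_step S V E s m s' \<Longrightarrow> pebble_play S V E s' ms s'' \<Longrightarrow>
    pebble_play S V E s (m # ms) s''"

definition complete_game :: "nat \<Rightarrow> 'v set \<Rightarrow> 'v set \<Rightarrow> 'v rel \<Rightarrow> 'v move list \<Rightarrow> bool" where
  "complete_game S V I E ms \<longleftrightarrow> (\<exists>R W. pebble_play S V E ({}, I) ms (R, W) \<and> V \<subseteq> W)"

definition num_loads :: "'v move list \<Rightarrow> nat" where
  "num_loads ms = length (filter is_Load ms)"

text \<open>
  The minimum is taken in \<^typ>\<open>enat\<close>: it is attained whenever a complete game exists, and it is
  \<open>\<infinity>\<close> if \<open>S\<close> is too small to complete any game.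
\<close>

definition io_complexity :: "nat \<Rightarrow> 'v set \<Rightarrow> 'v set \<Rightarrow> 'v rel \<Rightarrow> enat" where
  "io_complexity S V I E = (INF ms \<in> {ms. complete_game S V I E ms}. enat (num_loads ms))"

subsection \<open>Householder QR, V2Q part\<close>

datatype loc = A nat nat | Tau nat

datatype stmt =
    TauInit nat nat       \<comment> \<open>\<open>k j\<close>: \<open>tau[j] = 0.0\<close>\<close>
  | TauAcc nat nat nat    \<comment> \<open>\<open>k j i\<close>: \<open>tau[j] += A[i][k] * A[i][j]\<close>\<close>
  | TauScale nat nat      \<comment> \<open>\<open>k j\<close>: \<open>tau[j] *= tau[k]\<close>\<close>
  | Diag nat              \<comment> \<open>\<open>k\<close>: \<open>A[k][k] = 1.0 - tau[k]\<close>\<close>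
  | Row nat nat           \<comment> \<open>\<open>k j\<close>: \<open>A[k][j] = -tau[j]\<close>\<close>
  | Upd nat nat nat       \<comment> \<open>\<open>k j i\<close>: \<open>A[i][j] -= A[i][k] * tau[j]\<close>\<close>
  | Col nat nat           \<comment> \<open>\<open>k i\<close>: \<open>A[i][k] = -A[i][k] * tau[k]\<close>\<close>

fun stmt_reads :: "stmt \<Rightarrow> loc set" where
  "stmt_reads (TauInit k j) = {}"
| "stmt_reads (TauAcc k j i) = {Tau j, A i k, A i j}"
| "stmt_reads (TauScale k j) = {Tau j, Tau k}"
| "stmt_reads (Diag k) = {Tau k}"
| "stmt_reads (Row k j) = {Tau j}"
| "stmt_reads (Upd k j i) = {A i j, A i k, Tau j}"
| "stmt_reads (Col k i) = {A i k, Tau k}"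

fun stmt_target :: "stmt \<Rightarrow> loc" where
  "stmt_target (TauInit k j) = Tau j"
| "stmt_target (TauAcc k j i) = Tau j"
| "stmt_target (TauScale k j) = Tau j"
| "stmt_target (Diag k) = A k k"
| "stmt_target (Row k j) = A k j"
| "stmt_target (Upd k j i) = A i j"
| "stmt_target (Col k i) = A i k"

definition v2q_iteration :: "nat \<Rightarrow> nat \<Rightarrow> nat \<Rightarrow> stmt list" where
  "v2q_iteration M N k =
     concat (map (\<lambda>j. TauInit k j # map (\<lambda>i. TauAcc k j i) [k+1..<M]) [k+1..<N]) @
     map (\<lambda>j. TauScale k j) [k+1..<N] @
     [Diag k] @
     map (\<lambda>j. Row k j) [k+1..<N] @
     concat (map (\<lambda>j. map (\<lambda>i. Upd k j i) [k+1..<M]) [k+1..<N]) @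
     map (\<lambda>i. Col k i) [k+1..<M]"

definition v2q_trace :: "nat \<Rightarrow> nat \<Rightarrow> stmt list" where
  "v2q_trace M N = concat (map (v2q_iteration M N) (rev [0..<N]))"

lemma distinct_concat_map:
  assumes "distinct xs" "\<And>x. x \<in> set xs \<Longrightarrow> distinct (f x)"
    and "\<And>x y. x \<in> set xs \<Longrightarrow> y \<in> set xs \<Longrightarrow> x \<noteq> y \<Longrightarrow> set (f x) \<inter> set (f y) = {}"
  shows "distinct (concat (map f xs))"
  using assms by (induction xs) auto

lemma distinct_v2q_trace: "distinct (v2q_trace M N)"
proof -
  have "distinct (v2q_iteration M N k)" for k
    unfolding v2q_iteration_def
    by (auto simp: distinct_map inj_on_def simp del: upt_Suc intro!: distinct_concat_map)
  then show ?thesis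
    unfolding v2q_trace_def
    by (intro distinct_concat_map) (auto simp: v2q_iteration_def)
qed

definition v2q_io_complexity :: "nat \<Rightarrow> nat \<Rightarrow> nat \<Rightarrow> enat" where
  "v2q_io_complexity M N S =
     io_complexity S
       (cdag_nodes stmt_reads stmt_target (v2q_trace M N))
       (cdag_inputs stmt_reads stmt_target (v2q_trace M N))
       (cdag_edges stmt_reads stmt_target (v2q_trace M N))"

end

theory Submission
  imports Defs "HOL-Library.Product_Lexorder"
begin

text \<open>
  Cut a game into segments with at most \<open>S\<close> loads each, and let \<open>C\<close> be the set of nodes computed
  in a segment. All predecessors of \<open>C\<close> outside \<open>C\<close> lie in the set \<open>P\<close> of nodes that are red at the
  start or loaded during the segment, so \<open>card P \<le> 2 * S\<close>; moreover \<open>C\<close> is convex.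
  If column \<open>j\<close> is updated in \<open>C\<close> at iterations \<open>k1 < k < k2\<close>, then the reduction into \<open>tau[j]\<close>
  followed by its broadcast (the ``hourglass'') forces the whole update of column \<open>j\<close> at iteration
  \<open>k\<close> into \<open>C\<close>, which costs \<open>M - N\<close> elements of \<open>P\<close> for column \<open>k\<close> and as many for column \<open>j\<close>.
  Such columns are therefore few, at most \<open>card P / (M - N)\<close>. In any other column each entry is
  updated at most twice and can be charged to an element of \<open>P\<close> of its own. Hence a segment
  contains at most \<open>2 * card P + M * (card P / (M - N))\<^sup>2\<close> updates, and a game with \<open>Q\<close> loads contains
  at most \<open>4 * Q * (1 + S * M / (M - N)\<^sup>2)\<close>.
\<close>

subsection \<open>Dependencies of the program\<close>

text \<open>A lexicographic timestamp: the iteration (negated, since \<open>k\<close> runs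
  downwards), the phase within it, then the loop indices. \<open>Suc i\<close> keeps 0 free for
  \<open>TauInit\<close>.\<close>

fun stmt_time :: "stmt \<Rightarrow> int \<times> nat \<times> nat \<times> nat" where
  "stmt_time (TauInit k j) = (- int k, 0, j, 0)"
| "stmt_time (TauAcc k j i) = (- int k, 0, j, Suc i)"
| "stmt_time (TauScale k j) = (- int k, 1, j, 0)"
| "stmt_time (Diag k) = (- int k, 2, 0, 0)"
| "stmt_time (Row k j) = (- int k, 3, j, 0)"
| "stmt_time (Upd k j i) = (- int k, 4, j, i)"
| "stmt_time (Col k i) = (- int k, 5, i, 0)"

lemma sorted_wrt_concat_map:
  assumes "sorted_wrt Q xs" and "\<And>x. x \<in> set xs \<Longrightarrow> sorted_wrt P (f x)"
    and "\<And>x y a b. x \<in> set xs \<Longrightarrow> y \<in> set xs \<Longrightarrow> Q x y \<Longrightarrow> a \<in> set (f x) \<Longrightarrow> b \<in> set (f y) \<Longrightarrow> P a b"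
  shows "sorted_wrt P (concat (map f xs))"
  using assms
proof (induction xs)
  case (Cons x xs)
  have "sorted_wrt P (concat (map f xs))"
  proof (rule Cons.IH)
    show "P a b" if "y \<in> set xs" "z \<in> set xs" "Q y z" "a \<in> set (f y)" "b \<in> set (f z)" for y z a b
      using Cons.prems(3)[of y z a b] that by simp
  qed (use Cons.prems in auto)
  then show ?case
    using Cons.prems by (fastforce simp: sorted_wrt_append)
qed simp

lemma set_v2q_trace: "s \<in> set (v2q_trace M N) \<longleftrightarrow> (\<exists>k<N. s \<in> set (v2q_iteration M N k))"
  by (auto simp: v2q_trace_def)

lemma v2q_trace_iff [simp]:
  "TauInit k j \<in> set (v2q_trace M N) \<longleftrightarrow> k < j \<and> j < N"
  "TauAcc k j i \<in> set (v2q_trace M N) \<longleftrightarrow> k < j \<and> j < N \<and> k < i \<and> i < M"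
  "TauScale k j \<in> set (v2q_trace M N) \<longleftrightarrow> k < j \<and> j < N"
  "Diag k \<in> set (v2q_trace M N) \<longleftrightarrow> k < N"
  "Row k j \<in> set (v2q_trace M N) \<longleftrightarrow> k < j \<and> j < N"
  "Upd k j i \<in> set (v2q_trace M N) \<longleftrightarrow> k < j \<and> j < N \<and> k < i \<and> i < M"
  "Col k i \<in> set (v2q_trace M N) \<longleftrightarrow> k < N \<and> k < i \<and> i < M"
  by (auto simp: set_v2q_trace v2q_iteration_def image_iff)

lemma stmt_target_eq [simp]:
  "stmt_target w = Tau j \<longleftrightarrow> (\<exists>k. w = TauInit k j) \<or> (\<exists>k i. w = TauAcc k j i) \<or> (\<exists>k. w = TauScale k j)"
  "stmt_target w = A i j \<longleftrightarrow> w = Diag i \<and> i = j \<or> w = Row i j \<or> (\<exists>k. w = Upd k j i) \<or> w = Col j i"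
  by (cases w; auto)+

lemma sorted_v2q_trace: "sorted_wrt (\<lambda>s t. stmt_time s < stmt_time t) (v2q_trace M N)"
proof -
  have "sorted_wrt (\<lambda>s t. stmt_time s < stmt_time t) (v2q_iteration M N k)" for k
    unfolding v2q_iteration_def sorted_wrt_append
    by (auto simp: sorted_wrt_map simp del: upt_Suc
        intro!: sorted_wrt_concat_map[where Q = "(<)"])
  moreover have "fst (stmt_time s) = - int k" if "s \<in> set (v2q_iteration M N k)" for s k
    using that by (auto simp: v2q_iteration_def)
  then have "stmt_time s < stmt_time t"
    if "s \<in> set (v2q_iteration M N k)" "t \<in> set (v2q_iteration M N l)" "l < k" for s t k l
    using that by (simp add: less_prod_def')
  moreover have "sorted_wrt (>) (rev [0..<N])"
    by (simp add: sorted_wrt_rev)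
  ultimately show ?thesis
    unfolding v2q_trace_def by (blast intro: sorted_wrt_concat_map)
qed

lemma sorted_wrt_split:
  fixes f :: "'a \<Rightarrow> 'b::linorder"
  assumes "sorted_wrt (\<lambda>s t. f s < f t) xs" and "v \<in> set xs"
  obtains ys zs where "xs = ys @ v # zs" "\<And>w. w \<in> set ys \<Longrightarrow> f w < f v" "\<And>w. w \<in> set zs \<Longrightarrow> f v < f w"
proof -
  obtain ys zs where "xs = ys @ v # zs"
    using assms(2) by (auto simp: in_set_conv_decomp)
  with assms(1) that show ?thesis
    by (auto simp: sorted_wrt_append)
qed

abbreviation v2q_edges :: "nat \<Rightarrow> nat \<Rightarrow> (loc, stmt) node rel" where
  "v2q_edges M N \<equiv> cdag_edges stmt_reads stmt_target (v2q_trace M N)"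

text \<open>Replaces the list splitting in the definition of an edge by timestamp comparisons, which
  \<open>auto\<close> decides for concrete statements.\<close>

lemma input_edgeI:
  assumes "v \<in> set (v2q_trace M N)" "l \<in> stmt_reads v"
    and "\<And>w. w \<in> set (v2q_trace M N) \<Longrightarrow> stmt_time w < stmt_time v \<Longrightarrow> stmt_target w \<noteq> l"
  shows "(Input l, Instance v) \<in> v2q_edges M N"
proof -
  obtain xs ys where "v2q_trace M N = xs @ v # ys" "\<And>w. w \<in> set xs \<Longrightarrow> stmt_time w < stmt_time v"
    using sorted_wrt_split[OF sorted_v2q_trace assms(1)] by metis
  with assms show ?thesis
    unfolding cdag_edges_def reads_initial_def by auto
qed

lemma flow_edgeI:
  assumes "u \<in> set (v2q_trace M N)" "v \<in> set (v2q_trace M N)" "stmt_time u < stmt_time v"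
    and "stmt_target u \<in> stmt_reads v"
    and "\<And>w. w \<in> set (v2q_trace M N) \<Longrightarrow> stmt_time u < stmt_time w \<Longrightarrow> stmt_time w < stmt_time v
           \<Longrightarrow> stmt_target w \<noteq> stmt_target u"
  shows "(Instance u, Instance v) \<in> v2q_edges M N"
proof -
  obtain xs zs where 1: "v2q_trace M N = xs @ v # zs" "\<And>w. w \<in> set xs \<Longrightarrow> stmt_time w < stmt_time v"
    "\<And>w. w \<in> set zs \<Longrightarrow> stmt_time v < stmt_time w"
    using sorted_wrt_split[OF sorted_v2q_trace assms(2)] by metis
  have "sorted_wrt (\<lambda>s t. stmt_time s < stmt_time t) xs"
    using sorted_v2q_trace[of M N] 1(1) by (simp add: sorted_wrt_append)
  moreover have "u \<in> set xs"
    using assms(1,3) 1(1,3) by (metis Un_iff insert_iff list.simps(15) order_less_asym set_append)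
  ultimately obtain as bs where "xs = as @ u # bs" "\<And>w. w \<in> set bs \<Longrightarrow> stmt_time u < stmt_time w"
    using sorted_wrt_split by metis
  with 1 assms(4,5) have "v2q_trace M N = as @ u # bs @ v # zs" "\<forall>w\<in>set bs. stmt_target w \<noteq> stmt_target u"
    by auto
  with assms(4) have "flow_dep stmt_reads stmt_target (v2q_trace M N) u v"
    unfolding flow_dep_def by blast
  then show ?thesis
    unfolding cdag_edges_def by blast
qed

section \<open>Edges used in the counting argument\<close>

lemma edge_input:
  assumes "k < N" "k < i" "i < M"
  shows "k < j \<Longrightarrow> j < N \<Longrightarrow> (Input (A i k), Instance (Upd k j i)) \<in> v2q_edges M N"
    and "k < j \<Longrightarrow> j < N \<Longrightarrow> (Input (A i k), Instance (TauAcc k j i)) \<in> v2q_edges M N"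
    and "(Input (A i k), Instance (Col k i)) \<in> v2q_edges M N"
  using assms by - (rule input_edgeI; auto)+

lemma edge_tau_diag: "k < N \<Longrightarrow> (Input (Tau k), Instance (Diag k)) \<in> v2q_edges M N"
  by (rule input_edgeI) auto

text \<open>Iteration \<open>Suc k\<close> runs just before \<open>k\<close> and is the last to
  write this entry. Its pivot row and column are written by other statements, treated in
  \<open>edge_col\<close>, \<open>edge_diag\<close> and \<open>edge_row\<close>.\<close>

lemma edge_upd:
  assumes "Suc k < j" "j < N" "Suc k < i" "i < M"
  shows "(Instance (Upd (Suc k) j i), Instance (Upd k j i)) \<in> v2q_edges M N"
    and "(Instance (Upd (Suc k) j i), Instance (TauAcc k j i)) \<in> v2q_edges M N"
  using assms by - (rule flow_edgeI; auto)+

lemma edge_col: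
  assumes "Suc k < N" "Suc k < i" "i < M"
  shows "(Instance (Col (Suc k) i), Instance (Upd k (Suc k) i)) \<in> v2q_edges M N"
    and "(Instance (Col (Suc k) i), Instance (TauAcc k (Suc k) i)) \<in> v2q_edges M N"
  using assms by - (rule flow_edgeI; auto)+

lemma edge_diag:
  "Suc k < N \<Longrightarrow> Suc k < M \<Longrightarrow> (Instance (Diag (Suc k)), Instance (Upd k (Suc k) (Suc k))) \<in> v2q_edges M N"
  by (rule flow_edgeI) auto

lemma edge_row:
  "Suc k < j \<Longrightarrow> j < N \<Longrightarrow> Suc k < M \<Longrightarrow> (Instance (Row (Suc k) j), Instance (Upd k j (Suc k))) \<in> v2q_edges M N"
  by (rule flow_edgeI) auto

lemma edge_tau_scale:
  assumes "k < j" "j < N"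
  shows "k < i \<Longrightarrow> i < M \<Longrightarrow> (Instance (TauScale k j), Instance (Upd k j i)) \<in> v2q_edges M N"
    and "(Instance (TauScale k j), Instance (Row k j)) \<in> v2q_edges M N"
  using assms by - (rule flow_edgeI; auto)+

lemma edge_tau_acc:
  assumes "k < j" "j < N" "k < i"
  shows "Suc i < M \<Longrightarrow> (Instance (TauAcc k j i), Instance (TauAcc k j (Suc i))) \<in> v2q_edges M N"
    and "Suc i = M \<Longrightarrow> (Instance (TauAcc k j i), Instance (TauScale k j)) \<in> v2q_edges M N"
  using assms by - (rule flow_edgeI; auto)+

subsection \<open>Segments of a game\<close>

text \<open>
  The cell \<open>(j, i)\<close>, column before row, is the one whose updates a node of \<open>P\<close> pays for: mostly
  the entry \<open>A i j\<close> it holds. For \<open>i < j\<close> the entry is created from \<open>tau[j]\<close> by \<open>Row i j\<close>, so the nodes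
  computing that value belong to the cell as well; likewise \<open>Input (Tau j)\<close> for \<open>Diag j\<close>.
\<close>

fun cell :: "(loc, stmt) node \<Rightarrow> nat \<times> nat" where
  "cell (Input (A i j)) = (j, i)"
| "cell (Input (Tau j)) = (j, j)"
| "cell (Instance (TauInit k j)) = (j, k)"
| "cell (Instance (TauAcc k j i)) = (j, k)"
| "cell (Instance (TauScale k j)) = (j, k)"
| "cell (Instance (Diag k)) = (k, k)"
| "cell (Instance (Row k j)) = (j, k)"
| "cell (Instance (Upd k j i)) = (j, i)"
| "cell (Instance (Col k i)) = (k, i)"

text \<open>\<open>W\<close> and \<open>W'\<close> stand for the white nodes before and after a
  segment, \<open>P\<close> for the nodes red at its start or loaded in it. The counting uses only
  these closure properties, not the moves.\<close>

locale v2q_segment =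
  fixes M N :: nat and W W' P :: "(loc, stmt) node set"
  assumes N_less_M: "N < M"
    and finite_P: "finite P"
    and inputs: "cdag_inputs stmt_reads stmt_target (v2q_trace M N) \<subseteq> W"
    and down: "(u, v) \<in> v2q_edges M N \<Longrightarrow> v \<in> W \<Longrightarrow> u \<in> W"
    and down': "(u, v) \<in> v2q_edges M N \<Longrightarrow> v \<in> W' \<Longrightarrow> u \<in> W'"
    and pred: "(u, v) \<in> v2q_edges M N \<Longrightarrow> v \<in> W' - W \<Longrightarrow> u \<in> P \<or> u \<in> W' - W"
begin

definition C :: "(loc, stmt) node set" where
  "C = W' - W"

lemma pred_cell:
  assumes "(u, v) \<in> v2q_edges M N" "v \<in> C"
  shows "cell u \<in> cell ` P \<or> u \<in> C"
  using pred assms unfolding C_def by blast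

lemma pred_input:
  assumes "(Input l, v) \<in> v2q_edges M N" "v \<in> C"
  shows "cell (Input l) \<in> cell ` P"
proof -
  have "Input l \<in> W"
    using assms(1) inputs unfolding cdag_edges_def cdag_inputs_def by blast
  then show ?thesis
    using pred assms unfolding C_def by blast
qed

text \<open>Both \<open>W\<close> and \<open>W'\<close> are closed under predecessors:
  \<open>w\<close> is in \<open>W'\<close> because \<open>v\<close> is, and \<open>w\<close> in
  \<open>W\<close> would put \<open>u\<close> in \<open>W\<close>.\<close>

lemma C_convex:
  assumes "u \<in> C" "(u, w) \<in> (v2q_edges M N)\<^sup>*" "(w, v) \<in> (v2q_edges M N)\<^sup>*" "v \<in> C"
  shows "w \<in> C"
proof -
  have "x \<in> W" if "(x, y) \<in> (v2q_edges M N)\<^sup>*" "y \<in> W" for x y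
    using that by (induction rule: converse_rtrancl_induct) (auto intro: down)
  moreover have "x \<in> W'" if "(x, y) \<in> (v2q_edges M N)\<^sup>*" "y \<in> W'" for x y
    using that by (induction rule: converse_rtrancl_induct) (auto intro: down')
  ultimately show ?thesis
    using assms unfolding C_def by blast
qed

lemma tau_acc_reaches_tau_scale:
  assumes "i < M" "k < i" "k < j" "j < N"
  shows "(Instance (TauAcc k j i), Instance (TauScale k j)) \<in> (v2q_edges M N)\<^sup>*"
  using assms
proof (induction i rule: strict_inc_induct)
  case (base i)
  then show ?case
    by (intro r_into_rtrancl edge_tau_acc) auto
next
  case (step i)
  then show ?case
    using edge_tau_acc(1)[of k j N i M] by (meson Suc_lessI converse_rtrancl_into_rtrancl less_SucI not_less_eq order_less_trans)
qed

text \<open>The hourglass: an updated entry enters the reduction into \<open>tau[j]\<close> of the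
  next iteration, whose result is broadcast to all rows. Hence \<open>i\<close> and
  \<open>i'\<close> are unrelated.\<close>

lemma upd_reaches_upd:
  assumes "k < k'" "k' < j" "j < N" "k < i" "i < M" "k' < i'" "i' < M"
  shows "(Instance (Upd k' j i'), Instance (Upd k j i)) \<in> (v2q_edges M N)\<^sup>*"
  using assms
proof (induction k arbitrary: i rule: strict_inc_induct)
  case (base k)
  have "(Instance (Upd (Suc k) j i'), Instance (TauAcc k j i')) \<in> v2q_edges M N"
    using base by (intro edge_upd) auto
  moreover have "(Instance (TauAcc k j i'), Instance (TauScale k j)) \<in> (v2q_edges M N)\<^sup>*"
    using base by (intro tau_acc_reaches_tau_scale) auto
  moreover have "(Instance (TauScale k j), Instance (Upd k j i)) \<in> v2q_edges M N"
    using base by (intro edge_tau_scale) auto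
  ultimately show ?case
    using base by (meson converse_rtrancl_into_rtrancl rtrancl.rtrancl_into_rtrancl)
next
  case (step k)
  \<comment> \<open>Row \<open>Suc (Suc k)\<close> is the first one updated at iteration
    \<open>Suc k\<close>; it serves to enter the reduction of iteration \<open>k\<close>.\<close>
  have "(Instance (Upd k' j i'), Instance (Upd (Suc k) j (Suc (Suc k)))) \<in> (v2q_edges M N)\<^sup>*"
    using step N_less_M by (intro step.IH) auto
  moreover have "(Instance (Upd (Suc k) j (Suc (Suc k))), Instance (TauAcc k j (Suc (Suc k)))) \<in> v2q_edges M N"
    using step N_less_M by (intro edge_upd) auto
  moreover have "(Instance (TauAcc k j (Suc (Suc k))), Instance (TauScale k j)) \<in> (v2q_edges M N)\<^sup>*"
    using step N_less_M by (intro tau_acc_reaches_tau_scale) auto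
  moreover have "(Instance (TauScale k j), Instance (Upd k j i)) \<in> v2q_edges M N"
    using step by (intro edge_tau_scale) auto
  ultimately show ?case
    by (meson rtrancl_trans rtrancl.rtrancl_into_rtrancl)
qed

section \<open>Charging updates to cells of \<open>P\<close>\<close>

lemma charge_col: "Instance (Col j i) \<in> C \<Longrightarrow> j < N \<Longrightarrow> j < i \<Longrightarrow> i < M \<Longrightarrow> (j, i) \<in> cell ` P"
  using pred_input[OF edge_input(3)[of j N i M]] by simp

text \<open>The earlier versions of the entry form a chain through updates and
  \<open>Col j i\<close> back to its input. All have cell \<open>(j, i)\<close>, and the chain must
  leave \<open>C\<close> through a node of \<open>P\<close>.\<close>

lemma charge_upd_below_diag:
  assumes "k < j" "j < N" "j < i" "i < M" "Instance (Upd k j i) \<in> C"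
  shows "(j, i) \<in> cell ` P"
  using assms
proof (induction k rule: strict_inc_induct)
  case (base k)
  then have "(Instance (Col j i), Instance (Upd k j i)) \<in> v2q_edges M N"
    using edge_col(1)[of k N i M] by simp
  then show ?case
    using base by (auto dest!: pred_cell intro: charge_col)
next
  case (step k)
  then show ?case
    using pred_cell[OF edge_upd(1)[of k j N i M]] by auto
qed

lemma charge_tau_acc:
  assumes "k < j" "j < N" "j < i" "i < M" "Instance (TauAcc k j i) \<in> C"
  shows "(j, i) \<in> cell ` P"
proof (cases "j = Suc k")
  case True
  then have "(Instance (Col j i), Instance (TauAcc k j i)) \<in> v2q_edges M N"
    using edge_col(2)[of k N i M] assms by simp
  then show ?thesis
    using assms by (auto dest!: pred_cell intro: charge_col)
next
  case False
  then have "(Instance (Upd (Suc k) j i), Instance (TauAcc k j i)) \<in> v2q_edges M N"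
    using assms by (intro edge_upd) auto
  then show ?thesis
    using assms False by (auto dest!: pred_cell intro: charge_upd_below_diag[of "Suc k"])
qed

lemma charge_upd_diag:
  assumes "k < j" "j < N" "Instance (Upd k j j) \<in> C"
  shows "(j, j) \<in> cell ` P"
  using assms
proof (induction k rule: strict_inc_induct)
  case (base k)
  then have "(Instance (Diag j), Instance (Upd k j j)) \<in> v2q_edges M N"
    using edge_diag[of k N M] N_less_M by simp
  then show ?case
    using base pred_cell[of "Instance (Diag j)"] pred_input[OF edge_tau_diag[of j N M]] by auto
next
  case (step k)
  then show ?case
    using N_less_M pred_cell[OF edge_upd(1)[of k j N j M]] by auto
qed

text \<open>
  If the second alternative holds, then \<open>C\<close> contains a complete reduction of column \<open>j\<close>, and
  \<open>j\<close> is a heavy column by \<open>tau_acc_row_heavy\<close>.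
\<close>

lemma charge_upd_above_diag:
  assumes "k < i" "i < j" "j < N" "Instance (Upd k j i) \<in> C"
  shows "(j, i) \<in> cell ` P \<or> (\<forall>i'. i < i' \<and> i' < M \<longrightarrow> Instance (TauAcc i j i') \<in> C)"
  using assms
proof (induction k rule: strict_inc_induct)
  case (base k)
  show ?case
  proof (cases "(j, i) \<in> cell ` P")
    case *: False
    have "Instance (Row i j) \<in> C"
      using base * N_less_M pred_cell[OF edge_row[of k j N M]] by auto
    then have scale: "Instance (TauScale i j) \<in> C"
      using base * pred_cell[OF edge_tau_scale(2)[of i j N M]] by auto
    \<comment> \<open>Every \<open>TauAcc i j i'\<close> has cell \<open>(j, i)\<close>, which is
      uncharged, so membership in \<open>C\<close> propagates back from the last row.\<close>
    have "\<forall>i'. i < i' \<and> i' < M \<longrightarrow> Instance (TauAcc i j i') \<in> C"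
    proof (intro allI impI, elim conjE)
      fix i' assume "i' < M" "i < i'"
      then show "Instance (TauAcc i j i') \<in> C"
      proof (induction i' rule: strict_inc_induct)
        case (base i')
        then show ?case
          using scale * \<open>i < j\<close> \<open>j < N\<close> pred_cell[OF edge_tau_acc(2)[of i j N i' M]] by auto
      next
        case (step i')
        then show ?case
          using * \<open>i < j\<close> \<open>j < N\<close> pred_cell[OF edge_tau_acc(1)[of i j N i' M]] by auto
      qed
    qed
    then show ?thesis ..
  qed simp
next
  case (step k)
  then show ?case
    using N_less_M pred_cell[OF edge_upd(1)[of k j N i M]] by auto
qed

section \<open>Heavy and light columns\<close>

definition D :: "nat set" where
  "D = {d. d < N \<and> (\<forall>i\<in>{N..<M}. (d, i) \<in> cell ` P)}"

definition T :: "nat \<Rightarrow> (nat \<times> nat) set" where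
  "T j = {(k, i). k < j \<and> k < i \<and> i < M \<and> Instance (Upd k j i) \<in> C}"

definition heavy :: "nat \<Rightarrow> bool" where
  "heavy j \<longleftrightarrow> j \<in> D \<and> (\<exists>k\<in>D. k < j)"

text \<open>
  A heavy column \<open>j\<close> is updated in \<open>C\<close> at iterations from \<open>D\<close> and at most two others. The requirement
  that some \<open>k \<in> D\<close> lies below \<open>j\<close> excludes the least element of \<open>D\<close>, which leaves room for those two:
  \<open>(card D - 1) * (card D + 1) \<le> (card D)\<^sup>2\<close>.
\<close>

lemma finite_D: "finite D"
  unfolding D_def by simp

lemma finite_T: "finite (T j)"
  by (rule finite_subset[of _ "{..<j} \<times> {..<M}"]) (auto simp: T_def)

text \<open>Rows from \<open>N\<close> on lie below the diagonal in every column, so each member of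
  \<open>D\<close> accounts for \<open>M - N\<close> cells, disjoint from those of the
  others.\<close>

lemma card_D: "card D * (M - N) \<le> card P"
proof -
  have "card (D \<times> {N..<M}) \<le> card (cell ` P)"
    using finite_P by (intro card_mono) (auto simp: D_def)
  also have "\<dots> \<le> card P"
    using finite_P by (rule card_image_le)
  finally show ?thesis
    by (simp add: card_cartesian_product)
qed

text \<open>The reduction reads column \<open>j\<close>, charged by \<open>charge_tau_acc\<close>,
  and the inputs of column \<open>k\<close>, which can only come from \<open>P\<close>.\<close>

lemma tau_acc_row_heavy:
  assumes "k < j" "j < N" "\<And>i. k < i \<Longrightarrow> i < M \<Longrightarrow> Instance (TauAcc k j i) \<in> C"
  shows "heavy j"
proof -
  have "j \<in> D"
    using assms by (auto simp: D_def intro: charge_tau_acc)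
  moreover have "(k, i) \<in> cell ` P" if "i \<in> {N..<M}" for i
    using pred_input[OF edge_input(2)[of k N i M j]] assms that by auto
  then have "k \<in> D"
    using assms by (auto simp: D_def)
  ultimately show ?thesis
    using assms unfolding heavy_def by blast
qed

text \<open>By the hourglass, each update of column \<open>j\<close> at iteration \<open>k\<close>
  lies on a path between the two given ones; convexity puts it in \<open>C\<close>.\<close>

lemma interior_level:
  assumes "j < N" "(k1, i1) \<in> T j" "(k2, i2) \<in> T j" "k1 < k" "k < k2"
  shows "k \<in> D" "heavy j"
proof -
  have C: "Instance (Upd k j i) \<in> C" if "i \<in> {N..<M}" for i
    by (rule C_convex[of "Instance (Upd k2 j i2)" _ "Instance (Upd k1 j i1)"])
      (use assms that in \<open>auto simp: T_def intro!: upd_reaches_upd\<close>)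
  have "k < j"
    using assms by (auto simp: T_def)
  then show "k \<in> D"
    using C assms(1) pred_input[OF edge_input(1)[of k N _ M j]] by (force simp: D_def)
  moreover have "j \<in> D"
    using C assms(1) \<open>k < j\<close> by (auto simp: D_def intro: charge_upd_below_diag[of k])
  ultimately show "heavy j"
    using \<open>k < j\<close> unfolding heavy_def by blast
qed

lemma levels:
  assumes "j < N" "(k, i) \<in> T j"
  shows "k \<in> D - {j} \<or> k = Min (fst ` T j) \<or> k = Max (fst ` T j)"
    and "\<not> heavy j \<Longrightarrow> k = Min (fst ` T j) \<or> k = Max (fst ` T j)"
proof -
  let ?L = "fst ` T j"
  have L: "finite ?L" "?L \<noteq> {}" "k \<in> ?L"
    using finite_T assms(2) by force+
  then have "Min ?L \<in> ?L" "Max ?L \<in> ?L" and le: "Min ?L \<le> k" "k \<le> Max ?L"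
    by auto
  then obtain i1 i2 where "(Min ?L, i1) \<in> T j" "(Max ?L, i2) \<in> T j"
    by auto
  then have *: "k \<in> D" "heavy j" if "Min ?L < k" "k < Max ?L"
    using interior_level[OF assms(1)] that by blast+
  have "k \<noteq> j"
    using assms(2) by (auto simp: T_def)
  then show "k \<in> D - {j} \<or> k = Min ?L \<or> k = Max ?L"
    using le * by (auto simp: le_less)
  show "k = Min ?L \<or> k = Max ?L" if "\<not> heavy j"
    using le * that by (auto simp: le_less)
qed

text \<open>The factor 2 counts the first and last iterations, the only ones possible. Each updated
  row is charged, since the alternative in \<open>charge_upd_above_diag\<close> would make
  \<open>j\<close> heavy.\<close>

lemma card_T_light:
  assumes "j < N" "\<not> heavy j"
  shows "card (T j) \<le> 2 * card {p \<in> P. fst (cell p) = j}"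
proof -
  let ?L = "fst ` T j" and ?I = "snd ` cell ` {p \<in> P. fst (cell p) = j}"
  have "(j, i) \<in> cell ` P" if T: "(k, i) \<in> T j" for k i
  proof -
    consider "j < i" | "j = i" | "i < j"
      by linarith
    then show ?thesis
    proof cases
      case 3
      then show ?thesis
        using T assms charge_upd_above_diag[of k i j] tau_acc_row_heavy[of i j] by (auto simp: T_def)
    qed (use T assms charge_upd_below_diag charge_upd_diag in \<open>auto simp: T_def\<close>)
  qed
  moreover have "i \<in> ?I" if i: "(j, i) \<in> cell ` P" for i
  proof -
    from i obtain p where "p \<in> P" "cell p = (j, i)"
      by (metis imageE)
    then show ?thesis
      by (intro image_eqI[of _ snd "(j, i)"] image_eqI[of _ cell p]) auto
  qed
  ultimately have "T j \<subseteq> {Min ?L, Max ?L} \<times> ?I"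
    using levels(2)[OF assms(1) _ assms(2)] by (intro subsetI) clarsimp
  then have "card (T j) \<le> card ({Min ?L, Max ?L} \<times> ?I)"
    using finite_P by (intro card_mono) auto
  also have "\<dots> \<le> 2 * card ?I"
    unfolding card_cartesian_product by (intro mult_right_mono) (simp_all add: card_insert_le_m1)
  also have "card ?I \<le> card {p \<in> P. fst (cell p) = j}"
    unfolding image_image using finite_P by (intro card_image_le) simp
  finally show ?thesis
    by simp
qed

lemma card_T_heavy:
  assumes "j < N" "heavy j"
  shows "card (T j) \<le> (card D + 1) * M"
proof -
  let ?L = "fst ` T j"
  have "T j \<subseteq> ((D - {j}) \<union> {Min ?L, Max ?L}) \<times> {..<M}"
    using levels(1)[OF assms(1)] by (auto simp: T_def)
  then have "card (T j) \<le> card (((D - {j}) \<union> {Min ?L, Max ?L}) \<times> {..<M})"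
    using finite_D by (intro card_mono) auto
  also have "\<dots> = card ((D - {j}) \<union> {Min ?L, Max ?L}) * M"
    by (simp add: card_cartesian_product)
  also have "card ((D - {j}) \<union> {Min ?L, Max ?L}) \<le> card (D - {j}) + card {Min ?L, Max ?L}"
    by (rule card_Un_le)
  also have "\<dots> \<le> card (D - {j}) + 2"
    by (simp add: card_insert_le_m1)
  \<comment> \<open>A heavy \<open>j\<close> belongs to \<open>D\<close>, so its removal saves
    one.\<close>
  also have "card (D - {j}) + 2 = card D + 1"
    using assms(2) finite_D card_gt_0_iff[of D] by (auto simp: heavy_def)
  finally show ?thesis
    by simp
qed

lemma card_heavy: "card {j. heavy j} \<le> card D - 1"
proof (cases "D = {}")
  case False
  then have "{j. heavy j} \<subseteq> D - {Min D}"
    using finite_D by (auto simp: heavy_def dest: Min_le[of D])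
  then have "card {j. heavy j} \<le> card (D - {Min D})"
    using finite_D by (intro card_mono) auto
  then show ?thesis
    using finite_D False by simp
qed (simp add: heavy_def)

lemma sum_card_T: "(\<Sum>j<N. card (T j)) \<le> 2 * card P + (card D)\<^sup>2 * M"
proof -
  let ?H = "{j. heavy j}" and ?P = "\<lambda>j. {p \<in> P. fst (cell p) = j}"
  have H: "?H \<subseteq> {..<N}"
    by (auto simp: heavy_def D_def)
  have "(\<Sum>j<N. card (T j)) = (\<Sum>j\<in>{..<N} - ?H. card (T j)) + (\<Sum>j\<in>?H. card (T j))"
    using H by (intro sum.subset_diff) auto
  also have "\<dots> \<le> (\<Sum>j\<in>{..<N} - ?H. 2 * card (?P j)) + (\<Sum>j\<in>?H. (card D + 1) * M)"
    using H by (intro add_mono sum_mono card_T_light card_T_heavy) auto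
  also have "(\<Sum>j\<in>?H. (card D + 1) * M) \<le> (card D - 1) * ((card D + 1) * M)"
    using card_heavy by simp
  also have "(card D - 1) * ((card D + 1) * M) \<le> (card D)\<^sup>2 * M"
    by (cases "card D") (auto simp: power2_eq_square algebra_simps)
  also have "(\<Sum>j\<in>{..<N} - ?H. 2 * card (?P j)) \<le> 2 * card P"
  proof -
    \<comment> \<open>A node has one cell, hence one column, so different columns are charged to
      disjoint parts of \<open>P\<close>.\<close>
    have "(\<Sum>j\<in>{..<N} - ?H. card (?P j)) = card (\<Union>j\<in>{..<N} - ?H. ?P j)"
      using finite_P by (intro card_UN_disjoint[symmetric]) auto
    also have "\<dots> \<le> card P"
      using finite_P by (intro card_mono) auto
    finally show ?thesis
      by (simp flip: sum_distrib_left)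
  qed
  finally show ?thesis
    by simp
qed

end

section \<open>Counting the updates in a segment and in the program\<close>

definition upd_nodes :: "nat \<Rightarrow> nat \<Rightarrow> (loc, stmt) node set" where
  "upd_nodes M N = {Instance (Upd k j i) | k j i. k < j \<and> j < N \<and> k < i \<and> i < M}"

lemma (in v2q_segment) card_upd_nodes_segment:
  "real (card (upd_nodes M N \<inter> (W' - W)))
     \<le> 2 * real (card P) + real M * (real (card P))\<^sup>2 / (real M - real N)\<^sup>2"
proof -
  have "upd_nodes M N \<inter> (W' - W) \<subseteq> (\<Union>j<N. (\<lambda>(k, i). Instance (Upd k j i)) ` T j)"
    by (fastforce simp: upd_nodes_def T_def C_def)
  then have "card (upd_nodes M N \<inter> (W' - W)) \<le> card (\<Union>j<N. (\<lambda>(k, i). Instance (Upd k j i) :: (loc, stmt) node) ` T j)"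
    using finite_T by (intro card_mono) auto
  also have "\<dots> \<le> (\<Sum>j<N. card ((\<lambda>(k, i). Instance (Upd k j i) :: (loc, stmt) node) ` T j))"
    by (intro card_UN_le) auto
  also have "\<dots> \<le> (\<Sum>j<N. card (T j))"
    using finite_T by (intro sum_mono card_image_le) auto
  also have "\<dots> \<le> 2 * card P + (card D)\<^sup>2 * M"
    by (rule sum_card_T)
  finally have "real (card (upd_nodes M N \<inter> (W' - W))) \<le> real (2 * card P + (card D)\<^sup>2 * M)"
    by (rule of_nat_mono)
  moreover have "real (card D) \<le> real (card P) / (real M - real N)"
  proof -
    have "real (card D * (M - N)) \<le> real (card P)"
      using card_D by (rule of_nat_mono)
    then show ?thesis
      using N_less_M by (simp add: field_simps of_nat_diff)
  qed
  then have "(real (card D))\<^sup>2 * real M \<le> (real (card P) / (real M - real N))\<^sup>2 * real M"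
    by (intro mult_right_mono power_mono) auto
  ultimately show ?thesis
    by (simp add: power_divide mult.commute)
qed

lemma upd_nodes_eq:
  "upd_nodes M N = (\<lambda>(k, j, i). Instance (Upd k j i)) ` (SIGMA k:{..<N}. {k<..<N} \<times> {k<..<M})"
  by (auto simp: upd_nodes_def image_iff Bex_def)

lemma finite_upd_nodes: "finite (upd_nodes M N)"
  by (simp add: upd_nodes_eq)

lemma card_upd_nodes:
  assumes "N < M"
  shows "6 * real (card (upd_nodes M N)) = real N * (real N - 1) * (3 * real M - real N - 1)"
proof -
  have "card (upd_nodes M N) = card (SIGMA k:{..<N}. {k<..<N} \<times> {k<..<M})"
    by (simp add: upd_nodes_eq card_image inj_on_def split_beta prod_eq_iff)
  also have "\<dots> = (\<Sum>k<N. (N - Suc k) * (M - Suc k))"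
    by (simp add: card_cartesian_product)
  finally have "real (card (upd_nodes M N)) = (\<Sum>k<N. real ((N - Suc k) * (M - Suc k)))"
    by simp
  also have "\<dots> = (\<Sum>k<N. (real N - 1 - real k) * (real M - 1 - real k))"
    using assms by (intro sum.cong) (auto simp: of_nat_diff diff_diff_eq)
  finally have card: "real (card (upd_nodes M N)) = \<dots>" .
  \<comment> \<open>Freeing \<open>a\<close> and \<open>b\<close> from \<open>N\<close> and
    \<open>M\<close> lets the induction vary only the range of summation.\<close>
  have "6 * (\<Sum>k<n. (a - real k) * (b - real k))
      = 6 * real n * a * b - 3 * (a + b) * real n * (real n - 1) + real n * (real n - 1) * (2 * real n - 1)"
    for n a b
    by (induction n) (auto simp: algebra_simps)
  from this[of "real N - 1" "real M - 1" N] show ?thesis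
    unfolding card by (simp add: algebra_simps)
qed

subsection \<open>Loads and computed nodes\<close>

text \<open>The last conjunct supplies \<open>down\<close> and \<open>down'\<close> at the ends of a
  segment; \<open>Compute\<close> preserves it because red nodes are white.\<close>

definition pebble_inv :: "nat \<Rightarrow> 'v set \<Rightarrow> 'v rel \<Rightarrow> 'v set \<times> 'v set \<Rightarrow> bool" where
  "pebble_inv S I E s \<longleftrightarrow> finite (fst s) \<and> card (fst s) \<le> S \<and> fst s \<subseteq> snd s \<and> I \<subseteq> snd s \<and>
     (\<forall>(u, v)\<in>E. v \<in> snd s \<longrightarrow> u \<in> snd s)"

lemma pebble_step_inv:
  assumes "pebble_step S V E s m s'" "pebble_inv S I E s"
  shows "pebble_inv S I E s'"
  using assms
proof cases
  case (spill v R W)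
  then show ?thesis
    using assms(2) card_Diff1_le[of R v] by (auto simp: pebble_inv_def)
qed (use assms(2) in \<open>auto simp: pebble_inv_def\<close>)

lemma pebble_play_inv: "pebble_play S V E s ms s' \<Longrightarrow> pebble_inv S I E s \<Longrightarrow> pebble_inv S I E s'"
  by (induction rule: pebble_play.induct) (auto dest: pebble_step_inv)

lemma pebble_play_mono: "pebble_play S V E s ms s' \<Longrightarrow> snd s \<subseteq> snd s'"
  by (induction rule: pebble_play.induct) (auto elim!: pebble_step.cases)

lemma pebble_play_append:
  "pebble_play S V E s (ms @ ms') s'' \<Longrightarrow> \<exists>s'. pebble_play S V E s ms s' \<and> pebble_play S V E s' ms' s''"
proof (induction ms arbitrary: s)
  case (Cons m ms)
  from Cons.prems obtain t where "pebble_step S V E s m t" "pebble_play S V E t (ms @ ms') s''"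
    by (auto elim: pebble_play.cases)
  with Cons.IH show ?case
    by (blast intro: pebble_play.Cons)
qed (auto intro: pebble_play.Nil)

definition loaded :: "'v move list \<Rightarrow> 'v set" where
  "loaded ms = {v. Load v \<in> set ms}"

lemma loaded_simps [simp]:
  "loaded [] = {}"
  "loaded (Load v # ms) = insert v (loaded ms)"
  "loaded (Compute v # ms) = loaded ms"
  "loaded (Spill v # ms) = loaded ms"
  by (auto simp: loaded_def)

lemma finite_loaded [simp]: "finite (loaded ms)"
  and card_loaded_le: "card (loaded ms) \<le> num_loads ms"
proof -
  have "finite (loaded ms) \<and> card (loaded ms) \<le> num_loads ms"
  proof (induction ms)
    case (Cons m ms)
    then show ?case
      by (cases m) (auto simp: num_loads_def card_insert_if)
  qed (simp add: num_loads_def)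
  then show "finite (loaded ms)" "card (loaded ms) \<le> num_loads ms"
    by auto
qed

text \<open>Generalised for induction: \<open>W0\<close> stays the initial white set while the state
  advances, and \<open>X\<close> absorbs each loaded node. Any other red node was computed since the
  start.\<close>

lemma pebble_play_preds:
  assumes "pebble_play S V E s ms s'" "W0 \<subseteq> snd s" "fst s \<subseteq> X \<union> (snd s - W0)"
    and "(u, v) \<in> E" "v \<in> snd s' - snd s"
  shows "u \<in> X \<union> loaded ms \<union> (snd s' - W0)"
  using assms
proof (induction arbitrary: X rule: pebble_play.induct)
  case (Cons s m t ms s')
  note mono = pebble_play_mono[OF Cons.hyps(2)]
  from Cons.hyps(1) show ?case
  proof cases
    case (spill w R W)
    then show ?thesis
      using Cons.IH[of X] Cons.prems by auto
  next
    case (compute w W R)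
    show ?thesis
    proof (cases "v = w")
      case True
      then have "u \<in> R"
        using compute Cons.prems by auto
      then show ?thesis
        using compute Cons.prems mono by auto
    next
      case False
      then show ?thesis
        using compute Cons.IH[of X] Cons.prems by auto
    qed
  next
    case (load w R W)
    then show ?thesis
      using Cons.IH[of "insert w X"] Cons.prems by auto
  qed
qed simp

lemma split_loads:
  "n \<le> num_loads ms \<Longrightarrow> \<exists>ms1 ms2. ms = ms1 @ ms2 \<and> num_loads ms1 = n"
proof (induction ms rule: rev_induct)
  case (snoc m ms)
  show ?case
  proof (cases "n \<le> num_loads ms")
    case True
    then show ?thesis
      using snoc.IH by (metis append.assoc)
  next
    case False
    then have "num_loads (ms @ [m]) = n"
      using snoc.prems by (auto simp: num_loads_def split: if_splits)
    then show ?thesis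
      by blast
  qed
qed (simp add: num_loads_def)

text \<open>
  Bounding the initial red pebbles by \<open>a\<close> each, on top of \<open>2 * a\<close> per load, absorbs the rounding
  loss of the last, incomplete segment.
\<close>

lemma card_computed_le:
  fixes a :: real
  assumes "S > 0" "0 \<le> a" "finite T"
    and segment: "\<And>R W ms R' W'. pebble_inv S I E (R, W) \<Longrightarrow> pebble_play S V E (R, W) ms (R', W')
      \<Longrightarrow> num_loads ms \<le> S \<Longrightarrow> real (card (T \<inter> (W' - W))) \<le> a * (real (card R) + real (num_loads ms))"
    and "pebble_inv S I E (R, W)" "pebble_play S V E (R, W) ms (R', W')"
  shows "real (card (T \<inter> (W' - W))) \<le> a * (real (card R) + 2 * real (num_loads ms))"
  using assms(5,6)
proof (induction "length ms" arbitrary: ms R W rule: less_induct)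
  case less
  show ?case
  proof (cases "num_loads ms \<le> S")
    case True
    then have "real (card (T \<inter> (W' - W))) \<le> a * (real (card R) + real (num_loads ms))"
      using less.prems by (intro segment)
    also have "\<dots> \<le> a * (real (card R) + 2 * real (num_loads ms))"
      using \<open>0 \<le> a\<close> by (intro mult_left_mono) auto
    finally show ?thesis .
  next
    case False
    then obtain ms1 ms2 where ms: "ms = ms1 @ ms2" "num_loads ms1 = S"
      using split_loads[of S ms] by auto
    then have "length ms2 < length ms"
      using \<open>S > 0\<close> by (cases ms1) (auto simp: num_loads_def)
    from less.prems(2) obtain R1 W1
      where play: "pebble_play S V E (R, W) ms1 (R1, W1)" "pebble_play S V E (R1, W1) ms2 (R', W')"
      unfolding ms(1) by (force dest: pebble_play_append)
    have inv: "pebble_inv S I E (R1, W1)"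
      using pebble_play_inv play(1) less.prems(1) by blast
    have "real (card (T \<inter> (W' - W))) \<le> real (card (T \<inter> (W1 - W)) + card (T \<inter> (W' - W1)))"
      using \<open>finite T\<close> by (intro of_nat_mono order_trans[OF card_mono card_Un_le]) auto
    also have "\<dots> \<le> a * (real (card R) + real S) + a * (real (card R1) + 2 * real (num_loads ms2))"
      using segment[OF less.prems(1) play(1)] ms(2) less.hyps[OF \<open>length ms2 < length ms\<close> inv play(2)]
      by simp
    also have "\<dots> = a * (real (card R) + real (card R1) + real S + 2 * real (num_loads ms2))"
      by (simp add: algebra_simps)
    \<comment> \<open>Since \<open>card R1 \<le> S\<close>, the \<open>S\<close> loads of the first
      segment also pay for the red pebbles it leaves behind.\<close>
    also have "\<dots> \<le> a * (real (card R) + 2 * real S + 2 * real (num_loads ms2))"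
      using inv \<open>0 \<le> a\<close> by (intro mult_left_mono) (auto simp: pebble_inv_def)
    also have "\<dots> = a * (real (card R) + 2 * real (num_loads ms))"
      using ms by (simp add: num_loads_def algebra_simps)
    finally show ?thesis .
  qed
qed

section \<open>Lower bound on the loads of a complete game\<close>

lemma v2q_num_loads:
  assumes "S > 0" "N < M"
    and game: "complete_game S (cdag_nodes stmt_reads stmt_target (v2q_trace M N))
      (cdag_inputs stmt_reads stmt_target (v2q_trace M N)) (v2q_edges M N) ms"
  shows "real N * (real N - 1) * (3 * real M - real N - 1) * (real M - real N)^2
           / (24 * ((real M - real N)^2 + real S * real M)) \<le> real (num_loads ms)"
proof -
  let ?V = "cdag_nodes stmt_reads stmt_target (v2q_trace M N)"
  let ?I = "cdag_inputs stmt_reads stmt_target (v2q_trace M N)"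
  let ?E = "v2q_edges M N"
  define c where "c = real M / (real M - real N)\<^sup>2"
  have "c \<ge> 0"
    by (simp add: c_def)
  obtain R' W' where play: "pebble_play S ?V ?E ({}, ?I) ms (R', W')" "?V \<subseteq> W'"
    using game by (auto simp: complete_game_def)
  have init: "pebble_inv S ?I ?E ({}, ?I)"
    by (auto simp: pebble_inv_def cdag_inputs_def cdag_edges_def)
  have segment: "real (card (upd_nodes M N \<inter> (W' - W))) \<le> (2 + 2 * c * real S) * (real (card R) + real (num_loads ms))"
    if inv: "pebble_inv S ?I ?E (R, W)" and play: "pebble_play S ?V ?E (R, W) ms (R', W')"
      and S: "num_loads ms \<le> S" for R W ms R' W'
  proof -
    let ?P = "R \<union> loaded ms"
    have inv': "pebble_inv S ?I ?E (R', W')"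
      using pebble_play_inv play inv by blast
    interpret v2q_segment M N W W' ?P
    proof
      show "u \<in> ?P \<or> u \<in> W' - W" if "(u, v) \<in> ?E" "v \<in> W' - W" for u v
        using pebble_play_preds[OF play, of W R u v] that by auto
    qed (use inv inv' \<open>N < M\<close> in \<open>auto simp: pebble_inv_def\<close>)
    let ?p = "real (card ?P)" and ?k = "real (card R) + real (num_loads ms)"
    have "card ?P \<le> card R + num_loads ms"
      by (rule order_trans[OF card_Un_le]) (simp add: card_loaded_le)
    then have p: "?p \<le> ?k"
      by linarith
    also have "?k \<le> 2 * real S"
      using inv S by (simp add: pebble_inv_def)
    finally have "?p \<le> 2 * real S" .
    have segment: "real (card (upd_nodes M N \<inter> (W' - W))) \<le> (2 + c * ?p) * ?p"
      using card_upd_nodes_segment by (simp add: c_def power2_eq_square algebra_simps)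
    also have "\<dots> \<le> (2 + c * (2 * real S)) * ?k"
      using \<open>c \<ge> 0\<close> p \<open>?p \<le> 2 * real S\<close> by (intro mult_mono add_left_mono mult_left_mono) auto
    finally show ?thesis
      by (simp add: mult_ac)
  qed
  have "real (card (upd_nodes M N \<inter> (W' - ?I))) \<le> (2 + 2 * c * real S) * (2 * real (num_loads ms))"
    using card_computed_le[OF \<open>S > 0\<close> _ finite_upd_nodes segment init play(1)] \<open>c \<ge> 0\<close> by simp
  moreover have "upd_nodes M N \<inter> (W' - ?I) = upd_nodes M N"
    using play(2) by (auto simp: upd_nodes_def cdag_nodes_def cdag_inputs_def)
  \<comment> \<open>The constant 24 arises from \<open>6 * (2 + 2 * c * S) * 2\<close>.\<close>
  ultimately have "6 * real (card (upd_nodes M N)) \<le> 24 * (1 + c * real S) * real (num_loads ms)"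
    by (simp add: algebra_simps)
  then have *: "real N * (real N - 1) * (3 * real M - real N - 1) \<le> 24 * (1 + c * real S) * real (num_loads ms)"
    using card_upd_nodes[OF \<open>N < M\<close>] by simp
  let ?w = "(real M - real N)\<^sup>2"
  have "?w > 0"
    using \<open>N < M\<close> by simp
  then have w: "?w + real S * real M = (1 + c * real S) * ?w"
    by (simp add: c_def field_simps)
  have "real N * (real N - 1) * (3 * real M - real N - 1) * ?w \<le> real (num_loads ms) * (24 * (?w + real S * real M))"
    using mult_right_mono[OF *, of ?w] unfolding w by (simp only: mult_ac zero_le_power2 simp_thms)
  then show ?thesis
    using \<open>?w > 0\<close> by (intro divide_le_eq[THEN iffD2]) (auto simp: add_pos_nonneg mult_ac)
qed

text \<open>The order on \<open>enat\<close> is a well-order and the empty infimum is infinite, so a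
  finite infimum is a minimum.\<close>

lemma Inf_enat_attained: "Inf X = enat q \<Longrightarrow> enat q \<in> X"
  unfolding Inf_enat_def by (metis LeastI_ex ex_in_conv enat.distinct(1))

theorem theorem5:
  fixes M N S :: nat
  assumes "M > 0" and "N > 0" and "S > 0" and "M > N"
  shows "ereal (real N * (real N - 1) * (3 * real M - real N - 1) * (real M - real N)^2
           / (24 * ((real M - real N)^2 + real S * real M)))
         \<le> ereal_of_enat (v2q_io_complexity M N S)"
proof (cases "v2q_io_complexity M N S")
  case (enat q)
  let ?G = "{ms. complete_game S (cdag_nodes stmt_reads stmt_target (v2q_trace M N))
    (cdag_inputs stmt_reads stmt_target (v2q_trace M N)) (v2q_edges M N) ms}"
  have "Inf ((\<lambda>ms. enat (num_loads ms)) ` ?G) = enat q"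
    using enat by (simp add: v2q_io_complexity_def io_complexity_def)
  then have "enat q \<in> (\<lambda>ms. enat (num_loads ms)) ` ?G"
    by (rule Inf_enat_attained)
  then obtain ms where "ms \<in> ?G" "num_loads ms = q"
    by auto
  then show ?thesis
    using v2q_num_loads[of S N M ms] assms enat by simp
qed simp

end
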